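(* The 2-color Rado number of the equation $x^2+y^2=z^2$ is greater than $6500$ (possibly infinite). That is, there exists a coloring $\chi:\{1,2,\dots,6500\}\to\{1,2\}$ such that there are no $x,y,z\in\{1,2,\dots,6500\}$ with $x^2+y^2=z^2$ and $\chi(x)=\chi(y)=\chi(z)$.
   Context: For an equation $\mathcal{E}$ in several variables and a positive integer $r$, the $r$-color Rado number of $\mathcal{E}$ is the least positive integer $N$ such that every coloring $\chi:\{1,\dots,N\}\to\{1,\dots,r\}$ admits a monochromatic solution of $\mathcal{E}$ (a solution in which all variables take values in $\{1,\dots,N\}$ receiving the same color); it is $\infty$ if no such $N$ exists. The variables in a solution need not be distinct. *)

theory Defs
  imports Complex_Main "HOL-Library.FuncSet" "HOL-Library.Extended_Nat"
begin

text \<open>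
  An equation in \<open>k\<close> variables is represented by its
  solution set, a set of lists of length \<open>k\<close>; position \<open>i\<close> of a list is the value of the
  \<open>i\<close>-th variable. Positivity and the bound \<open>N\<close> are imposed by
  \<open>monochromatic_solution\<close>. Entries of a solution may coincide.
\<close>

type_synonym equation = "nat list set"

definition monochromatic_solution :: "equation \<Rightarrow> nat \<Rightarrow> (nat \<Rightarrow> nat) \<Rightarrow> nat list \<Rightarrow> bool" where
  "monochromatic_solution E N \<chi> xs \<longleftrightarrow>
     xs \<in> E \<and> set xs \<subseteq> {1..N} \<and> (\<forall>a\<in>set xs. \<forall>b\<in>set xs. \<chi> a = \<chi> b)"

definition rado_property :: "equation \<Rightarrow> nat \<Rightarrow> nat \<Rightarrow> bool" where
  "rado_property E r N \<longleftrightarrow>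
     (\<forall>\<chi> \<in> {1..N} \<rightarrow> {1..r}. \<exists>xs. monochromatic_solution E N \<chi> xs)"

text \<open>
  In \<open>enat\<close> a nonempty set contains its infimum, and the infimum of the
  empty set is \<open>\<infinity>\<close>.
\<close>

definition rado_number :: "equation \<Rightarrow> nat \<Rightarrow> enat" where
  "rado_number E r = Inf {enat N | N. N \<ge> 1 \<and> rado_property E r N}"

definition pythagorean_equation :: equation where
  "pythagorean_equation = {[x, y, z] | x y z. x\<^sup>2 + y\<^sup>2 = z\<^sup>2}"

end

theory Submission
  imports Defs "HOL-Computational_Algebra.Nth_Powers"
begin

text \<open>
  A coloring found by stochastic local search (WalkSAT, followed by simulated annealing to shrink
  one color class) is checked inside the kernel. Every Pythagorean triple is a multiple of one with
  legs \<open>m * m - n * n\<close> and \<open>2 * m * n\<close> and hypotenuse \<open>m * m + n * n\<close>, where \<open>d = m - n\<close> is odd, so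
  only finitely many triples \<open>(d, n, k)\<close> have to be examined. Writing the legs in terms of \<open>d\<close> and
  \<open>n\<close> avoids subtraction.
\<close>

section \<open>The explicit coloring\<close>

definition second_color :: "nat set" where
  "second_color = set
   [4, 8, 12, 21, 25, 26, 29, 30, 32, 34, 36, 39, 40, 44, 45, 48, 51, 52, 54, 56, 61, 63, 66, 67,
    70, 71, 78, 81, 82, 84, 88, 89, 91, 93, 94, 95, 97, 100, 101, 112, 114, 115, 116, 120, 121, 123,
    128, 132, 144, 145, 146, 147, 150, 153, 156, 158, 159, 160, 162, 170, 174, 175, 176, 177, 180,
    185, 186, 187, 188, 192, 195, 203, 204, 208, 210, 215, 216, 219, 221, 222, 224, 230, 231, 237,
    252, 258, 261, 265, 267, 268, 269, 273, 275, 280, 284, 285, 286, 289, 292, 295, 301, 303, 304,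
    305, 308, 309, 315, 318, 319, 321, 324, 325, 328, 329, 330, 336, 338, 341, 342, 343, 344, 345,
    353, 354, 357, 361, 362, 363, 364, 372, 375, 376, 377, 378, 387, 388, 389, 390, 400, 402, 404,
    406, 410, 415, 418, 424, 425, 426, 427, 429, 438, 440, 450, 452, 456, 460, 464, 465, 470, 471,
    480, 481, 490, 492, 493, 495, 498, 500, 506, 509, 510, 511, 513, 515, 520, 528, 532, 533, 540,
    544, 545, 548, 549, 551, 552, 555, 558, 562, 564, 565, 574, 576, 580, 585, 586, 588, 589, 594,
    600, 604, 609, 610, 611, 612, 615, 616, 617, 624, 627, 635, 637, 640, 644, 645, 646, 648, 649,
    651, 652, 654, 655, 666, 676, 678, 679, 680, 685, 695, 696, 698, 700, 702, 703, 704, 707, 709,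
    712, 717, 720, 729, 730, 733, 735, 740, 742, 744, 745, 746, 748, 749, 757, 764, 765, 768, 770,
    772, 779, 780, 782, 784, 790, 791, 792, 793, 795, 796, 802, 804, 805, 810, 812, 814, 816, 828,
    835, 840, 846, 857, 860, 861, 864, 865, 870, 874, 875, 881, 884, 885, 888, 895, 899, 902, 905,
    906, 910, 912, 915, 918, 920, 922, 923, 924, 932, 935, 936, 938, 940, 944, 945, 946, 948, 949,
    950, 957, 962, 964, 968, 969, 970, 978, 985, 988, 989, 992, 1001, 1005, 1008, 1010, 1012, 1016,
    1023, 1025, 1026, 1029, 1030, 1032, 1034, 1036, 1038, 1040, 1043, 1044, 1048, 1049, 1050, 1052,
    1053, 1054, 1055, 1060, 1062, 1065, 1068, 1070, 1071, 1073, 1074, 1077, 1078, 1084, 1088, 1089,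
    1095, 1098, 1100, 1102, 1105, 1107, 1112, 1115, 1117, 1119, 1120, 1125, 1127, 1128, 1131, 1132,
    1134, 1135, 1136, 1140, 1143, 1145, 1150, 1155, 1160, 1161, 1166, 1167, 1168, 1172, 1179, 1180,
    1182, 1183, 1185, 1186, 1190, 1191, 1193, 1196, 1201, 1204, 1210, 1212, 1213, 1220, 1221, 1224,
    1227, 1228, 1230, 1239, 1242, 1243, 1245, 1249, 1250, 1251, 1254, 1255, 1256, 1258, 1260, 1261,
    1267, 1268, 1271, 1272, 1274, 1284, 1285, 1287, 1288, 1295, 1299, 1302, 1306, 1311, 1312, 1314,
    1316, 1320, 1328, 1330, 1332, 1344, 1345, 1348, 1350, 1351, 1352, 1361, 1363, 1364, 1365, 1370,
    1371, 1372, 1374, 1375, 1377, 1378, 1380, 1381, 1384, 1385, 1387, 1388, 1394, 1395, 1398, 1405,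
    1407, 1411, 1416, 1421, 1425, 1430, 1431, 1433, 1435, 1440, 1445, 1452, 1455, 1460, 1462, 1463,
    1464, 1468, 1469, 1470, 1472, 1474, 1480, 1482, 1485, 1488, 1490, 1495, 1500, 1508, 1509, 1512,
    1513, 1528, 1537, 1545, 1547, 1550, 1551, 1552, 1554, 1555, 1556, 1557, 1564, 1565, 1569, 1573,
    1584, 1587, 1589, 1591, 1592, 1593, 1594, 1596, 1597, 1598, 1599, 1600, 1605, 1614, 1616, 1617,
    1618, 1620, 1624, 1625, 1635, 1638, 1639, 1640, 1641, 1642, 1647, 1648, 1650, 1655, 1656, 1659,
    1670, 1672, 1674, 1675, 1677, 1679, 1686, 1688, 1690, 1691, 1695, 1696, 1700, 1704, 1707, 1708,
    1709, 1710, 1713, 1717, 1721, 1724, 1725, 1739, 1740, 1742, 1743, 1744, 1745, 1746, 1755, 1760,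
    1765, 1768, 1771, 1777, 1781, 1784, 1785, 1792, 1796, 1800, 1802, 1804, 1805, 1806, 1810, 1812,
    1813, 1818, 1820, 1824, 1833, 1839, 1843, 1845, 1846, 1850, 1855, 1856, 1857, 1859, 1863, 1864,
    1869, 1870, 1878, 1880, 1886, 1895, 1896, 1903, 1904, 1915, 1917, 1919, 1920, 1921, 1925, 1927,
    1929, 1930, 1932, 1933, 1944, 1950, 1953, 1954, 1956, 1960, 1972, 1980, 1983, 1992, 1995, 2001,
    2005, 2007, 2008, 2010, 2015, 2016, 2018, 2024, 2028, 2030, 2032, 2035, 2036, 2040, 2041, 2044,
    2045, 2046, 2047, 2048, 2052, 2053, 2055, 2059, 2064, 2067, 2069, 2074, 2075, 2079, 2080, 2084,
    2094, 2095, 2097, 2104, 2105, 2112, 2115, 2117, 2122, 2123, 2125, 2127, 2130, 2132, 2135, 2137,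
    2144, 2150, 2160, 2162, 2163, 2168, 2169, 2173, 2175, 2176, 2183, 2186, 2192, 2195, 2204, 2205,
    2215, 2218, 2219, 2220, 2224, 2225, 2226, 2228, 2229, 2235, 2248, 2249, 2254, 2255, 2256, 2257,
    2260, 2263, 2264, 2265, 2270, 2273, 2277, 2283, 2288, 2291, 2292, 2294, 2295, 2296, 2298, 2300,
    2301, 2304, 2305, 2306, 2310, 2314, 2315, 2322, 2325, 2328, 2331, 2335, 2340, 2343, 2344, 2345,
    2346, 2349, 2352, 2355, 2356, 2360, 2365, 2366, 2368, 2370, 2375, 2376, 2378, 2381, 2384, 2388,
    2389, 2390, 2391, 2395, 2402, 2405, 2406, 2410, 2415, 2417, 2418, 2419, 2430, 2431, 2433, 2434,
    2435, 2436, 2438, 2441, 2445, 2448, 2449, 2455, 2456, 2460, 2463, 2468, 2469, 2470, 2472, 2480,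
    2481, 2482, 2485, 2488, 2490, 2492, 2493, 2495, 2496, 2499, 2500, 2505, 2508, 2509, 2511, 2512,
    2514, 2516, 2525, 2530, 2532, 2533, 2534, 2540, 2548, 2550, 2554, 2559, 2562, 2568, 2570, 2574,
    2575, 2580, 2583, 2584, 2585, 2586, 2588, 2589, 2590, 2592, 2600, 2610, 2616, 2620, 2624, 2625,
    2635, 2636, 2646, 2650, 2655, 2657, 2664, 2670, 2673, 2677, 2680, 2684, 2685, 2691, 2692, 2694,
    2696, 2701, 2705, 2712, 2713, 2715, 2720, 2721, 2723, 2725, 2728, 2730, 2732, 2739, 2740, 2747,
    2748, 2755, 2757, 2764, 2766, 2768, 2770, 2773, 2775, 2776, 2778, 2780, 2781, 2785, 2790, 2795,
    2800, 2805, 2808, 2809, 2813, 2815, 2820, 2821, 2828, 2829, 2832, 2833, 2834, 2835, 2837, 2838,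
    2842, 2847, 2848, 2850, 2853, 2856, 2857, 2861, 2864, 2868, 2870, 2872, 2873, 2883, 2884, 2885,
    2888, 2890, 2895, 2898, 2900, 2907, 2908, 2911, 2913, 2915, 2920, 2922, 2926, 2929, 2935, 2936,
    2940, 2944, 2952, 2955, 2957, 2959, 2960, 2961, 2962, 2964, 2965, 2967, 2968, 2973, 2975, 2976,
    2982, 2990, 2992, 2995, 2996, 3000, 3004, 3005, 3012, 3015, 3016, 3025, 3026, 3027, 3028, 3029,
    3032, 3035, 3036, 3040, 3042, 3045, 3047, 3048, 3050, 3051, 3057, 3060, 3061, 3071, 3072, 3076,
    3078, 3080, 3082, 3088, 3096, 3100, 3103, 3117, 3120, 3124, 3131, 3133, 3138, 3144, 3147, 3148,
    3150, 3155, 3156, 3157, 3159, 3161, 3164, 3170, 3171, 3172, 3177, 3180, 3189, 3190, 3192, 3196,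
    3204, 3205, 3207, 3209, 3211, 3216, 3220, 3225, 3227, 3230, 3237, 3239, 3243, 3245, 3246, 3248,
    3252, 3256, 3264, 3265, 3272, 3274, 3276, 3279, 3285, 3286, 3288, 3289, 3290, 3293, 3298, 3304,
    3306, 3309, 3310, 3312, 3315, 3318, 3327, 3328, 3330, 3333, 3336, 3340, 3355, 3356, 3357, 3360,
    3362, 3363, 3364, 3366, 3367, 3370, 3375, 3378, 3380, 3384, 3385, 3387, 3388, 3393, 3395, 3396,
    3403, 3404, 3405, 3408, 3423, 3428, 3430, 3440, 3441, 3445, 3447, 3450, 3460, 3465, 3468, 3469,
    3474, 3480, 3483, 3485, 3486, 3498, 3500, 3505, 3506, 3509, 3510, 3512, 3513, 3515, 3516, 3522,
    3524, 3530, 3531, 3532, 3536, 3540, 3544, 3555, 3560, 3563, 3565, 3569, 3570, 3575, 3584, 3585,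
    3594, 3595, 3596, 3597, 3608, 3609, 3612, 3615, 3618, 3619, 3620, 3624, 3630, 3632, 3636, 3637,
    3638, 3640, 3645, 3648, 3649, 3650, 3654, 3655, 3657, 3660, 3665, 3672, 3680, 3681, 3684, 3685,
    3687, 3689, 3695, 3696, 3705, 3712, 3716, 3717, 3718, 3720, 3724, 3730, 3731, 3732, 3735, 3736,
    3744, 3747, 3759, 3762, 3763, 3764, 3768, 3769, 3777, 3780, 3783, 3784, 3788, 3792, 3793, 3797,
    3800, 3811, 3815, 3816, 3819, 3820, 3828, 3831, 3837, 3842, 3843, 3848, 3849, 3852, 3855, 3856,
    3857, 3858, 3864, 3865, 3868, 3873, 3876, 3877, 3878, 3880, 3882, 3885, 3887, 3888, 3890, 3893,
    3894, 3895, 3897, 3904, 3906, 3910, 3912, 3915, 3916, 3918, 3920, 3922, 3927, 3928, 3930, 3934,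
    3936, 3940, 3942, 3946, 3948, 3952, 3953, 3963, 3965, 3970, 3971, 3980, 3984, 3992, 3994, 3996,
    4000, 4004, 4005, 4008, 4013, 4015, 4021, 4024, 4026, 4028, 4032, 4035, 4040, 4042, 4044, 4045,
    4059, 4062, 4067, 4081, 4082, 4084, 4085, 4087, 4088, 4095, 4100, 4102, 4112, 4114, 4120, 4121,
    4122, 4123, 4124, 4125, 4140, 4142, 4145, 4147, 4151, 4152, 4153, 4154, 4158, 4161, 4164, 4165,
    4168, 4176, 4180, 4181, 4182, 4186, 4187, 4199, 4200, 4210, 4215, 4216, 4217, 4218, 4220, 4221,
    4224, 4230, 4232, 4240, 4248, 4250, 4255, 4256, 4257, 4260, 4268, 4272, 4275, 4280, 4290, 4291,
    4292, 4295, 4296, 4297, 4304, 4306, 4308, 4321, 4322, 4329, 4330, 4335, 4340, 4345, 4347, 4355,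
    4356, 4359, 4360, 4361, 4364, 4365, 4370, 4376, 4380, 4381, 4382, 4385, 4386, 4392, 4400, 4404,
    4420, 4422, 4428, 4432, 4433, 4435, 4442, 4445, 4459, 4460, 4464, 4465, 4470, 4472, 4476, 4484,
    4487, 4488, 4500, 4503, 4505, 4515, 4520, 4522, 4532, 4536, 4539, 4545, 4548, 4551, 4552, 4553,
    4555, 4558, 4560, 4562, 4563, 4568, 4570, 4572, 4573, 4578, 4584, 4585, 4589, 4592, 4604, 4614,
    4615, 4616, 4623, 4624, 4628, 4641, 4653, 4655, 4656, 4657, 4660, 4664, 4668, 4671, 4672, 4673,
    4675, 4682, 4685, 4690, 4692, 4695, 4697, 4698, 4700, 4706, 4709, 4712, 4715, 4716, 4721, 4724,
    4728, 4732, 4736, 4740, 4743, 4746, 4748, 4753, 4755, 4756, 4758, 4760, 4764, 4765, 4768, 4770,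
    4774, 4776, 4779, 4784, 4785, 4788, 4790, 4791, 4795, 4800, 4803, 4806, 4810, 4840, 4844, 4848,
    4850, 4851, 4852, 4854, 4860, 4864, 4865, 4874, 4875, 4876, 4877, 4882, 4883, 4885, 4896, 4901,
    4902, 4905, 4909, 4911, 4913, 4914, 4915, 4916, 4917, 4929, 4930, 4941, 4944, 4949, 4950, 4952,
    4959, 4960, 4964, 4965, 4968, 4969, 4972, 4974, 4980, 4981, 4984, 4985, 4995, 4998, 5004, 5005,
    5015, 5016, 5028, 5031, 5032, 5035, 5040, 5057, 5060, 5061, 5064, 5065, 5070, 5072, 5081, 5083,
    5085, 5088, 5090, 5096, 5103, 5104, 5106, 5112, 5115, 5120, 5125, 5127, 5130, 5131, 5134, 5135,
    5136, 5145, 5148, 5151, 5152, 5156, 5160, 5162, 5163, 5165, 5170, 5172, 5175, 5180, 5185, 5189,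
    5194, 5200, 5206, 5208, 5213, 5215, 5217, 5222, 5224, 5232, 5235, 5236, 5237, 5244, 5247, 5249,
    5255, 5256, 5262, 5264, 5278, 5280, 5302, 5305, 5313, 5319, 5321, 5330, 5346, 5352, 5355, 5360,
    5365, 5369, 5376, 5388, 5389, 5390, 5400, 5402, 5404, 5406, 5408, 5412, 5415, 5418, 5425, 5429,
    5430, 5435, 5445, 5452, 5453, 5456, 5460, 5472, 5474, 5477, 5480, 5485, 5495, 5499, 5500, 5506,
    5512, 5520, 5535, 5542, 5543, 5544, 5545, 5561, 5565, 5570, 5583, 5585, 5589, 5592, 5593, 5597,
    5599, 5600, 5614, 5615, 5620, 5629, 5631, 5635, 5640, 5645, 5648, 5650, 5655, 5662, 5666, 5667,
    5670, 5676, 5678, 5680, 5681, 5695, 5704, 5712, 5718, 5720, 5725, 5727, 5733, 5735, 5746, 5747,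
    5751, 5760, 5762, 5765, 5770, 5777, 5785, 5795, 5805, 5808, 5809, 5813, 5815, 5820, 5824, 5832,
    5835, 5845, 5852, 5860, 5865, 5869, 5880, 5882, 5887, 5900, 5916, 5930, 5938, 5940, 5941, 5945,
    5947, 5949, 5951, 5952, 5954, 5955, 5965, 5972, 5975, 5982, 5985, 6001, 6002, 6005, 6010, 6018,
    6020, 6025, 6027, 6028, 6029, 6032, 6035, 6045, 6048, 6052, 6055, 6065, 6068, 6070, 6072, 6084,
    6085, 6088, 6093, 6105, 6108, 6109, 6110, 6115, 6118, 6125, 6126, 6130, 6138, 6150, 6155, 6159,
    6160, 6161, 6165, 6170, 6175, 6180, 6182, 6184, 6185, 6191, 6198, 6201, 6205, 6207, 6208, 6213,
    6222, 6224, 6232, 6235, 6245, 6250, 6253, 6257, 6260, 6275, 6278, 6280, 6282, 6290, 6292, 6293,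
    6302, 6304, 6305, 6310, 6315, 6320, 6335, 6341, 6344, 6345, 6350, 6355, 6362, 6370, 6371, 6375,
    6376, 6384, 6389, 6396, 6410, 6412, 6425, 6436, 6438, 6439, 6446, 6464, 6466, 6483, 6485, 6494,
    6496]"

section \<open>Binary tries for membership of numerals\<close>

datatype num_trie = Leaf | Node bool num_trie num_trie

text \<open>The constructors of \<open>num\<close> expose the least significant digit first, so a
  numeral spells out its own path from the root and no arithmetic on keys occurs.\<close>

fun trie_lookup :: "num_trie \<Rightarrow> num \<Rightarrow> bool" where
  "trie_lookup Leaf p = False"
| "trie_lookup (Node b l r) num.One = b"
| "trie_lookup (Node b l r) (num.Bit0 p) = trie_lookup l p"
| "trie_lookup (Node b l r) (num.Bit1 p) = trie_lookup r p"

fun trie_insert :: "num \<Rightarrow> num_trie \<Rightarrow> num_trie" where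
  "trie_insert num.One Leaf = Node True Leaf Leaf"
| "trie_insert (num.Bit0 p) Leaf = Node False (trie_insert p Leaf) Leaf"
| "trie_insert (num.Bit1 p) Leaf = Node False Leaf (trie_insert p Leaf)"
| "trie_insert num.One (Node b l r) = Node True l r"
| "trie_insert (num.Bit0 p) (Node b l r) = Node b (trie_insert p l) r"
| "trie_insert (num.Bit1 p) (Node b l r) = Node b l (trie_insert p r)"

lemma trie_lookup_insert:
  "trie_lookup (trie_insert p t) q \<longleftrightarrow> p = q \<or> trie_lookup t q"
proof (induction p t arbitrary: q rule: trie_insert.induct)
qed (case_tac q; auto)+

primrec trie_of_list :: "nat list \<Rightarrow> num_trie" where
  "trie_of_list [] = Leaf"
| "trie_of_list (x # xs) = trie_insert (num_of_nat x) (trie_of_list xs)"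

text \<open>\<open>num_of_nat\<close> inverts \<open>numeral\<close> only on positive numbers: it
  sends 0 to \<open>num.One\<close>, so an entry 0 would be stored as 1.\<close>

lemma trie_lookup_of_list:
  "0 \<notin> set xs \<Longrightarrow> trie_lookup (trie_of_list xs) p \<longleftrightarrow> numeral p \<in> set xs"
proof (induction xs)
  case (Cons x xs)
  then have "num_of_nat x = p \<longleftrightarrow> x = numeral p"
    by (metis gr0I list.set_intros(1) nat_of_num_numeral num_of_nat_inverse num_of_nat_numeral_eq)
  then show ?case
    using Cons by (auto simp: trie_lookup_insert)
qed simp

text \<open>On a concrete trie this unfolds into one fact about \<open>f\<close> per node; a leaf
  settles all numerals with the given low digits at once.\<close>

primrec trie_describes :: "(num \<Rightarrow> bool) \<Rightarrow> num_trie \<Rightarrow> bool" where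
  "trie_describes f Leaf \<longleftrightarrow> (\<forall>p. \<not> f p)"
| "trie_describes f (Node b l r) \<longleftrightarrow>
     (f num.One \<longleftrightarrow> b) \<and> trie_describes (\<lambda>p. f (num.Bit0 p)) l \<and> trie_describes (\<lambda>p. f (num.Bit1 p)) r"

lemma trie_describes_lookup: "trie_describes (trie_lookup t) t"
  by (induction t) simp_all

lemma trie_describes_of_list:
  assumes "S = set xs" "0 \<notin> S"
  shows "trie_describes (\<lambda>p. numeral p \<in> S) (trie_of_list xs)"
proof -
  have "(\<lambda>p. numeral p \<in> S) = trie_lookup (trie_of_list xs)"
    using assms by (auto simp: fun_eq_iff trie_lookup_of_list)
  then show ?thesis
    using trie_describes_lookup by simp
qed

lemma zero_notin_second_color: "0 \<notin> second_color"
  unfolding second_color_def by simp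

text \<open>
  Instantiating \<open>trie_describes_of_list\<close> and unfolding yields a conjunction of rewrite rules, one for
  each node and each leaf of the trie, that decide membership of any numeral in \<open>second_color\<close> in a
  single step; searching the list or the trie at every query would be far too slow.
\<close>

lemmas second_color_iff = trie_describes_of_list[OF second_color_def zero_notin_second_color,
  simplified trie_of_list.simps num_of_nat_numeral_eq num_of_nat_One trie_insert.simps trie_describes.simps]

section \<open>The finite check of all triples with hypotenuse at most 6500\<close>

definition not_monochromatic :: "nat \<Rightarrow> nat \<Rightarrow> nat \<Rightarrow> bool" where
  "not_monochromatic x y z \<longleftrightarrow>
     \<not> ((x \<in> second_color \<longleftrightarrow> y \<in> second_color) \<and> (y \<in> second_color \<longleftrightarrow> z \<in> second_color))"

text \<open>The current multiple \<open>x\<close>, \<open>y\<close>, \<open>z\<close> is kept apart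
  from the increments \<open>a\<close>, \<open>b\<close>, \<open>c\<close>, so that passing to the
  next multiple takes three additions.\<close>

definition multiples_ok :: "nat \<Rightarrow> nat \<Rightarrow> nat \<Rightarrow> nat \<Rightarrow> nat \<Rightarrow> nat \<Rightarrow> bool" where
  "multiples_ok a b c x y z \<longleftrightarrow>
     (\<forall>k. z + k * c \<le> 6500 \<longrightarrow> not_monochromatic (x + k * a) (y + k * b) (z + k * c))"

text \<open>
  \<open>family_ok\<close> exists only to make the simplifier normalize \<open>a\<close>, \<open>b\<close> and \<open>c\<close> before they are duplicated.
\<close>

definition family_ok :: "nat \<Rightarrow> nat \<Rightarrow> nat \<Rightarrow> bool" where
  "family_ok a b c \<longleftrightarrow> multiples_ok a b c a b c"

definition row_ok :: "nat \<Rightarrow> nat \<Rightarrow> bool" where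
  "row_ok d n \<longleftrightarrow> (\<forall>j\<ge>n. family_ok (d * d + 2 * (d * j)) (2 * (j * j) + 2 * (d * j))
     (j * j + (j + d) * (j + d)))"

text \<open>The step 2 preserves parity, so starting from 1 reaches exactly the odd
  differences.\<close>

definition rows_ok :: "nat \<Rightarrow> bool" where
  "rows_ok d \<longleftrightarrow> (\<forall>i. row_ok (d + 2 * i) 1)"

lemma all_nat_split: "(\<forall>k. P k) \<longleftrightarrow> P 0 \<and> (\<forall>k. P (Suc k))"
  by (metis not0_implies_Suc)

text \<open>The hypotenuses do not decrease along the multiples, so once one exceeds 6500 all
  remaining conditions are vacuous.\<close>

lemma multiples_ok_step:
  "multiples_ok a b c x y z \<longleftrightarrow>
     (if z \<le> 6500 then not_monochromatic x y z \<and> multiples_ok a b c (x + a) (y + b) (z + c) else True)"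
proof (cases "z \<le> 6500")
  case True
  from all_nat_split[of "\<lambda>k. z + k * c \<le> 6500 \<longrightarrow> not_monochromatic (x + k * a) (y + k * b) (z + k * c)"] True
  show ?thesis
    by (simp add: multiples_ok_def algebra_simps)
qed (simp add: multiples_ok_def)

lemma row_ok_step:
  "row_ok d n \<longleftrightarrow>
     (if n * n + (n + d) * (n + d) \<le> 6500
      then family_ok (d * d + 2 * (d * n)) (2 * (n * n) + 2 * (d * n)) (n * n + (n + d) * (n + d)) \<and>
        row_ok d (n + Numeral1)
      else True)"
proof (cases "n * n + (n + d) * (n + d) \<le> 6500")
  case True
  have "(\<forall>j\<ge>n. P j) \<longleftrightarrow> P n \<and> (\<forall>j\<ge>n + 1. P j)" for P :: "nat \<Rightarrow> bool"
    by (metis Suc_eq_plus1 le_refl le_SucI le_antisym not_less_eq_eq)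
  from this[of "\<lambda>j. family_ok (d * d + 2 * (d * j)) (2 * (j * j) + 2 * (d * j))
     (j * j + (j + d) * (j + d))"] True
  show ?thesis
    by (simp only: row_ok_def numeral_One if_True)
next
  case False
  \<comment> \<open>The hypotenuse grows with \<open>j\<close>, so every later family in the row
    starts beyond the bound.\<close>
  have "\<not> j * j + (j + d) * (j + d) \<le> 6500" if "j \<ge> n" for j
    using False that by (meson add_mono le_trans mult_le_mono le_refl)
  then have "row_ok d n"
    unfolding row_ok_def family_ok_def multiples_ok_def by (meson le_add1 le_trans)
  with False show ?thesis
    by simp
qed

lemma rows_ok_step:
  "rows_ok d \<longleftrightarrow> (if d * d \<le> 6500 then row_ok d (Numeral1) \<and> rows_ok (d + 2) else True)"
proof (cases "d * d \<le> 6500")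
  case True
  from all_nat_split[of "\<lambda>i. row_ok (d + 2 * i) 1"] True show ?thesis
    by (simp add: rows_ok_def add.assoc)
next
  case False
  \<comment> \<open>Each hypotenuse in this row or a later one is at least \<open>d * d\<close>,
    which makes that square a sufficient stopping test.\<close>
  have "\<not> j * j + (j + (d + 2 * i)) * (j + (d + 2 * i)) \<le> 6500" for i j
    using False mult_le_mono[of d "j + (d + 2 * i)" d "j + (d + 2 * i)"] by linarith
  then have "row_ok (d + 2 * i) n" for i n
    unfolding row_ok_def family_ok_def multiples_ok_def by (meson le_add1 le_trans)
  with False show ?thesis
    by (simp add: rows_ok_def)
qed

text \<open>
  The weak congruence rule keeps the unbounded recursion in the step equations from unfolding before
  its guard has been evaluated. \<open>Numeral1\<close> is used because \<open>1\<close> is not built by \<open>numeral\<close>.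
\<close>

lemma rows_ok_1: "rows_ok (Numeral1)"
  by (simp only: multiples_ok_step row_ok_step rows_ok_step not_monochromatic_def family_ok_def second_color_iff
      numeral_plus_numeral numeral_times_numeral add_num_simps mult_num_simps
      numeral_le_iff le_num_simps less_num_simps if_True if_False simp_thms cong: if_weak_cong)

section \<open>Parametrization of Pythagorean triples\<close>

text \<open>In x^2 = (z - y)(z + y), dividing both factors by their gcd \<open>g\<close> leaves
  coprime numbers whose product is a square; hence they are squares \<open>s\<^sup>2\<close> and
  \<open>t\<^sup>2\<close>. The parity of \<open>t - s\<close> decides which leg is the one of the
  form \<open>d * d + 2 * (d * n)\<close>.\<close>

lemma pythagorean_triple_cases:
  fixes x y z :: nat
  assumes eq: "x\<^sup>2 + y\<^sup>2 = z\<^sup>2" and pos: "x > 0" "y > 0"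
  obtains k n d where "k > 0" "n > 0" "odd d"
    "x = k * (d * d + 2 * (d * n)) \<and> y = k * (2 * (n * n) + 2 * (d * n)) \<or>
     y = k * (d * d + 2 * (d * n)) \<and> x = k * (2 * (n * n) + 2 * (d * n))"
    "z = k * (n * n + (n + d) * (n + d))"
proof -
  have "y\<^sup>2 < z\<^sup>2"
    using eq pos by (metis less_add_same_cancel2 zero_less_power)
  then have "y < z"
    by (simp add: power2_less_imp_less)
  define u v where "u = z - y" and "v = z + y"
  have uv: "u > 0" "u < v" "v = u + 2 * y" "z = u + y"
    using \<open>y < z\<close> pos by (auto simp: u_def v_def)
  have prod: "u * v = x\<^sup>2"
  proof -
    have "x\<^sup>2 + y\<^sup>2 = u * v + y\<^sup>2"
      unfolding eq uv(3,4) by (simp add: power2_eq_square algebra_simps)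
    then show ?thesis by simp
  qed
  define g where "g = gcd u v"
  have "g > 0"
    using uv by (simp add: g_def)
  obtain p q where pq: "u = g * p" "v = g * q" "coprime p q"
    using gcd_coprime_exists[of u v] \<open>g > 0\<close> unfolding g_def by (metis mult.commute less_numeral_extra(3))
  have gpq: "g\<^sup>2 * (p * q) = x\<^sup>2"
    using prod pq by (simp add: power2_eq_square algebra_simps)
  then have "g\<^sup>2 dvd x\<^sup>2"
    by (metis dvd_triv_left)
  \<comment> \<open>Divisibility between squares passes to the roots.\<close>
  then obtain w where w: "x = g * w"
    by (auto simp: pow_divides_pow_iff)
  have "p * q = w\<^sup>2"
    using gpq \<open>g > 0\<close> by (simp add: w power_mult_distrib)
  moreover have pq_pos: "p > 0" "q > 0"
    using pq uv by (auto intro!: Nat.gr0I)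
  ultimately have "is_nth_power 2 p" "is_nth_power 2 q"
    using is_nth_power_mult_coprime_natD[OF pq(3), of 2] by (auto simp: is_nth_power_def)
  then obtain s t where st: "p = s\<^sup>2" "q = t\<^sup>2"
    by (auto simp: is_nth_power_def)
  have "w\<^sup>2 = (s * t)\<^sup>2"
    using \<open>p * q = w\<^sup>2\<close> st by (simp add: power_mult_distrib)
  then have x: "x = g * (s * t)"
    by (simp add: w)
  have "s > 0"
    using st pq_pos by (auto intro!: Nat.gr0I)
  have "s\<^sup>2 < t\<^sup>2"
    using uv(2) pq st \<open>g > 0\<close> by simp
  then have "s < t"
    by (simp add: power2_less_imp_less)
  have "coprime s t"
    using pq(3) st by simp
  have y: "2 * y + g * s\<^sup>2 = g * t\<^sup>2" and z: "z = g * s\<^sup>2 + y"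
    using uv pq st by auto
  \<comment> \<open>Now \<open>x = g s t\<close>, \<open>2 y = g (t\<^sup>2 - s\<^sup>2)\<close> and \<open>2 z = g (t\<^sup>2 + s\<^sup>2)\<close>; if \<open>s\<close> and \<open>t\<close> are both odd, then
    \<open>m\<close> and \<open>n\<close> are their half sum and half difference, otherwise \<open>g\<close> is even and \<open>m = t\<close>, \<open>n = s\<close>.\<close>
  show thesis
  proof (cases "even (t - s)")
    case True
    then obtain n where n: "t = s + 2 * n"
      using \<open>s < t\<close> by (metis dvdE le_add_diff_inverse less_imp_le)
    \<comment> \<open>Here m = \<open>s + n\<close>, so the required odd difference m - n is
      \<open>s\<close> itself, with multiplier \<open>g\<close>. If \<open>s\<close> were even, so
      would be \<open>t\<close>, against coprimality.\<close>
    have "odd s"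
    proof
      assume "even s"
      then have "even t"
        using n by simp
      with \<open>even s\<close> \<open>coprime s t\<close> show False
        using coprime_common_divisor[of s t 2] by simp
    qed
    moreover have y': "y = g * (2 * (n * n) + 2 * (s * n))"
      using y by (simp add: n power2_eq_square algebra_simps)
    moreover have "x = g * (s * s + 2 * (s * n))"
      by (simp add: x n algebra_simps)
    moreover have "z = g * (n * n + (n + s) * (n + s))"
      using z y' by (simp add: power2_eq_square algebra_simps)
    moreover have "n > 0"
      using n \<open>s < t\<close> by simp
    ultimately show thesis
      using that \<open>g > 0\<close> by blast
  next
    case False
    define d where "d = t - s"
    have t: "t = s + d" and "odd d"
      using \<open>s < t\<close> False by (auto simp: d_def)
    have y': "2 * y = g * (d * d + 2 * (d * s))"
      using y by (simp add: t power2_eq_square algebra_simps)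
    then have "even (g * (d * d + 2 * (d * s)))"
      by (metis dvd_triv_left)
    \<comment> \<open>For odd \<open>d\<close> the factor \<open>d * d + 2 * (d * s)\<close> is odd,
      so \<open>g\<close> must supply the 2 on the left; half of \<open>g\<close> is the multiplier
      \<open>k\<close>.\<close>
    then have "even g"
      using \<open>odd d\<close> by simp
    then obtain k where k: "g = 2 * k" ..
    have y'': "y = k * (d * d + 2 * (d * s))"
      using y' k by simp
    moreover have "x = k * (2 * (s * s) + 2 * (d * s))"
      by (simp add: x t k algebra_simps)
    moreover have "z = k * (s * s + (s + d) * (s + d))"
      using z y'' k by (simp add: power2_eq_square algebra_simps)
    moreover have "k > 0"
      using k \<open>g > 0\<close> by simp
    ultimately show thesis
      using that \<open>odd d\<close> \<open>s > 0\<close> by blast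
  qed
qed

lemma not_monochromatic_pythagorean:
  assumes "x\<^sup>2 + y\<^sup>2 = z\<^sup>2" "x > 0" "y > 0" "z \<le> 6500"
  shows "not_monochromatic x y z"
  using assms(1-3)
proof (cases rule: pythagorean_triple_cases)
  case (1 k n d)
  define a b c where "a = d * d + 2 * (d * n)" and "b = 2 * (n * n) + 2 * (d * n)"
    and "c = n * n + (n + d) * (n + d)"
  \<comment> \<open>\<open>i\<close> is the index of the row of \<open>d\<close> in
    \<open>rows_ok\<close> started at 1.\<close>
  obtain i where "d = 1 + 2 * i"
    using \<open>odd d\<close> by (metis oddE add.commute)
  then have "multiples_ok a b c a b c"
    using rows_ok_1 \<open>n > 0\<close>
    unfolding rows_ok_def row_ok_def family_ok_def numeral_One a_def b_def c_def by simp
  \<comment> \<open>\<open>multiples_ok a b c a b c\<close> counts from the triple itself, so the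
    \<open>k\<close>-fold multiple has index \<open>k - 1\<close>.\<close>
  moreover obtain k' where k': "k = Suc k'"
    using \<open>k > 0\<close> gr0_implies_Suc by blast
  ultimately have "not_monochromatic (k * a) (k * b) (k * c)"
    using 1(5) assms(4) unfolding multiples_ok_def c_def[symmetric] by simp
  \<comment> \<open>The legs may come in either order; \<open>not_monochromatic\<close> is symmetric
    in them.\<close>
  then show ?thesis
    using 1(4,5) unfolding a_def[symmetric] b_def[symmetric] c_def[symmetric]
    by (auto simp: not_monochromatic_def)
qed

section \<open>From the coloring to the Rado number\<close>

theorem theorem3:
  "rado_number pythagorean_equation 2 > 6500 \<and>
   (\<exists>\<chi> :: nat \<Rightarrow> nat. \<chi> \<in> {1..6500} \<rightarrow> {1, 2} \<and>
      \<not> (\<exists>x\<in>{1..6500}. \<exists>y\<in>{1..6500}. \<exists>z\<in>{1..6500}.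
            x\<^sup>2 + y\<^sup>2 = z\<^sup>2 \<and> \<chi> x = \<chi> y \<and> \<chi> y = \<chi> z))"
proof
  define \<chi> :: "nat \<Rightarrow> nat" where "\<chi> n = (if n \<in> second_color then 2 else 1)" for n
  have no_mono: "\<not> (\<chi> x = \<chi> y \<and> \<chi> y = \<chi> z)"
    if "x\<^sup>2 + y\<^sup>2 = z\<^sup>2" "x > 0" "y > 0" "z \<le> 6500" for x y z
    using not_monochromatic_pythagorean[OF that] by (auto simp: \<chi>_def not_monochromatic_def)
  \<comment> \<open>\<open>\<chi>\<close> is defined on all naturals, so this single coloring
    refutes every \<open>N\<close> up to 6500.\<close>
  have not_rado: "\<not> rado_property pythagorean_equation 2 N" if "N \<le> 6500" for N
  proof
    assume "rado_property pythagorean_equation 2 N"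
    moreover have "\<chi> \<in> {1..N} \<rightarrow> {1..2}"
      by (auto simp: \<chi>_def)
    ultimately obtain xs where "monochromatic_solution pythagorean_equation N \<chi> xs"
      unfolding rado_property_def by blast
    then obtain x y z where "x\<^sup>2 + y\<^sup>2 = z\<^sup>2" and xyz: "set [x, y, z] \<subseteq> {1..N}"
      "\<forall>u\<in>set [x, y, z]. \<forall>v\<in>set [x, y, z]. \<chi> u = \<chi> v"
      unfolding monochromatic_solution_def pythagorean_equation_def by blast
    moreover have "\<chi> x = \<chi> y" "\<chi> y = \<chi> z"
      using xyz(2) by (meson list.set_intros)+
    ultimately show False
      using no_mono[of x y z] xyz(1) \<open>N \<le> 6500\<close> by simp
  qed
  show "rado_number pythagorean_equation 2 > 6500"
  proof (rule ccontr)
    let ?A = "{enat N | N. N \<ge> 1 \<and> rado_property pythagorean_equation 2 N}"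
    assume "\<not> rado_number pythagorean_equation 2 > 6500"
    then have le: "Inf ?A \<le> enat 6500"
      by (simp add: rado_number_def numeral_eq_enat not_less)
    \<comment> \<open>The infimum of the empty set would be infinite, against the finite
      bound.\<close>
    then have "?A \<noteq> {}"
      by (metis Inf_empty enat.distinct(2) enat_ord_code(3) order_antisym top_enat_def)
    \<comment> \<open>In \<open>enat\<close> the infimum of a nonempty set is its least element, so
      a bound of at most 6500 would be attained by some \<open>N\<close> already excluded.\<close>
    then have "Inf ?A \<in> ?A"
      unfolding Inf_enat_def by (metis (no_types, lifting) LeastI ex_in_conv)
    then obtain N where "Inf ?A = enat N" "rado_property pythagorean_equation 2 N"
      by auto
    with le not_rado show False
      by simp
  qed
  show "\<exists>\<chi> :: nat \<Rightarrow> nat. \<chi> \<in> {1..6500} \<rightarrow> {1, 2} \<and>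
      \<not> (\<exists>x\<in>{1..6500}. \<exists>y\<in>{1..6500}. \<exists>z\<in>{1..6500}.
            x\<^sup>2 + y\<^sup>2 = z\<^sup>2 \<and> \<chi> x = \<chi> y \<and> \<chi> y = \<chi> z)"
  proof (intro exI conjI)
    show "\<chi> \<in> {1..6500} \<rightarrow> {1, 2}"
      by (auto simp: \<chi>_def)
    show "\<not> (\<exists>x\<in>{1..6500}. \<exists>y\<in>{1..6500}. \<exists>z\<in>{1..6500}.
            x\<^sup>2 + y\<^sup>2 = z\<^sup>2 \<and> \<chi> x = \<chi> y \<and> \<chi> y = \<chi> z)"
      using no_mono by auto
  qed
qed

end
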